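(* Let $ABC$ be a triangle in the hyperbolic plane. Let $F$, $F_a$, $F_b$ and $F_c$ be the points of contact of the Euler circle of the triangle with the inscribed circle and with the corresponding escribed circles (opposite $A$, $B$, $C$ respectively). Let $I$ be the incenter of the triangle. Then the lines $FI$, $AF_a$, $BF_b$ and $CF_c$ are concurrent.
   Context: Let $M_a, M_b, M_c$ be the points on the sides $BC$, $CA$, $AB$ such that each of the cevians $AM_a$, $BM_b$, $CM_c$ bisects the hyperbolic area of triangle $ABC$. The Euler circle of the triangle is the circle through $M_a, M_b, M_c$; it is tangent to the inscribed circle and to the three escribed circles (the hyperbolic analogue of Feuerbach's theorem). The escribed circle opposite $A$ is the circle tangent to the three lines $BC$, $CA$, $AB$ lying in the angle $BAC$ on the other side of line $BC$ from $A$; similarly for $B$ and $C$. The incenter is the center of the inscribed circle. Throughout it is assumed that any two lines intersect and that three points determine a circle (in hyperbolic geometry lines may diverge and circles may degenerate into horocycles or equidistant curves; such cases are understood by analytic continuation). *)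

theory Defs
  imports "HOL-Analysis.Analysis"
begin

text \<open>
  The hyperbolic plane of curvature -1 in the Beltrami--Klein (projective) model: the points are
  those of the open unit disc and the lines are its open chords. Betweenness, segments, triangles
  (as convex hulls) and incidence are therefore the Euclidean ones; distance, circles and area
  are not.
\<close>

type_synonym point = "real^2"

definition hplane :: "point set" where
  "hplane = ball 0 1"

definition hline :: "point \<Rightarrow> point \<Rightarrow> point set" where
  "hline P Q = affine hull {P, Q} \<inter> hplane"

definition hdist :: "point \<Rightarrow> point \<Rightarrow> real" where
  "hdist X Y = arcosh ((1 - X \<bullet> Y) / (sqrt (1 - (norm X)\<^sup>2) * sqrt (1 - (norm Y)\<^sup>2)))"

definition hcircle :: "point \<Rightarrow> real \<Rightarrow> point set" where
  "hcircle Z r = {X \<in> hplane. hdist Z X = r}"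

text \<open>
  The integrand is the density of the Riemannian area form of the Klein metric.
\<close>

definition harea :: "point set \<Rightarrow> real" where
  "harea S = integral S (\<lambda>X. (1 - (norm X)\<^sup>2) powr (- 3 / 2))"

text \<open>
  Circles together with their degenerations. Under
  \<open>X \<mapsto> (1, X) / sqrt (1 - (norm X)\<^sup>2)\<close>, which identifies the disc with a sheet of the
  hyperboloid, the set below is a section by a plane that misses the origin: a circle, a horocycle
  or (one branch of) an equidistant curve according as \<open>norm n\<close> is less than, equal to or greater
  than \<open>\<bar>c\<bar>\<close>. Planes through the origin cut out the lines. Requiring two distinct points
  excludes empty and one-point sections.
\<close>

definition generalized_circle :: "point set \<Rightarrow> bool" where
  "generalized_circle \<Gamma> \<longleftrightarrow>
     (\<exists>n c. \<Gamma> = {X \<in> hplane. sqrt (1 - (norm X)\<^sup>2) = c - n \<bullet> X}) \<and>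
     (\<exists>X\<in>\<Gamma>. \<exists>Y\<in>\<Gamma>. X \<noteq> Y)"

text \<open>
  Tangency is expressed through Euclidean distances in the disc. Near a point of the disc these
  are bounded above and below by constant multiples of the hyperbolic ones, so the notion is the
  hyperbolic one. Meeting in exactly one point would not do: an equidistant curve can cross a line
  transversally in a single point.
\<close>

definition tangent_line_at :: "point set \<Rightarrow> point set \<Rightarrow> point \<Rightarrow> bool" where
  "tangent_line_at l \<Gamma> T \<longleftrightarrow>
     T \<in> l \<and> T \<in> \<Gamma> \<and> T islimpt \<Gamma> \<and>
     ((\<lambda>X. infdist X l / dist X T) \<longlongrightarrow> 0) (at T within \<Gamma>)"

definition tangent_line :: "point set \<Rightarrow> point set \<Rightarrow> bool" where
  "tangent_line l \<Gamma> \<longleftrightarrow> (\<exists>T. tangent_line_at l \<Gamma> T)"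

definition point_of_contact :: "point set \<Rightarrow> point set \<Rightarrow> point \<Rightarrow> bool" where
  "point_of_contact \<Gamma> \<Delta> T \<longleftrightarrow>
     (\<exists>P\<in>hplane. \<exists>Q\<in>hplane. P \<noteq> Q \<and>
        tangent_line_at (hline P Q) \<Gamma> T \<and> tangent_line_at (hline P Q) \<Delta> T)"

definition tangent_to_sidelines :: "point \<Rightarrow> point \<Rightarrow> point \<Rightarrow> point set \<Rightarrow> bool" where
  "tangent_to_sidelines A B C \<Gamma> \<longleftrightarrow>
     tangent_line (hline B C) \<Gamma> \<and> tangent_line (hline C A) \<Gamma> \<and> tangent_line (hline A B) \<Gamma>"

definition htriangle :: "point \<Rightarrow> point \<Rightarrow> point \<Rightarrow> bool" where
  "htriangle A B C \<longleftrightarrow> A \<in> hplane \<and> B \<in> hplane \<and> C \<in> hplane \<and> \<not> collinear {A, B, C}"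

text \<open>\<open>M\<close> is the foot, on the side \<open>BC\<close>, of the cevian from \<open>A\<close> that bisects the area.\<close>

definition bisecting_foot :: "point \<Rightarrow> point \<Rightarrow> point \<Rightarrow> point \<Rightarrow> bool" where
  "bisecting_foot A B C M \<longleftrightarrow>
     M \<in> closed_segment B C \<and>
     harea (convex hull {A, B, M}) = harea (convex hull {A, C, M})"

definition euler_circle :: "point \<Rightarrow> point \<Rightarrow> point \<Rightarrow> point set \<Rightarrow> bool" where
  "euler_circle A B C \<Gamma> \<longleftrightarrow>
     generalized_circle \<Gamma> \<and>
     (\<exists>Ma Mb Mc. bisecting_foot A B C Ma \<and> bisecting_foot B C A Mb \<and> bisecting_foot C A B Mc \<and>
        Ma \<in> \<Gamma> \<and> Mb \<in> \<Gamma> \<and> Mc \<in> \<Gamma>)"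

text \<open>An inscribed circle is always a genuine circle, so it comes with its center and radius.\<close>

definition inscribed_circle :: "point \<Rightarrow> point \<Rightarrow> point \<Rightarrow> point \<Rightarrow> real \<Rightarrow> bool" where
  "inscribed_circle A B C Z r \<longleftrightarrow>
     Z \<in> hplane \<and> 0 < r \<and>
     tangent_to_sidelines A B C (hcircle Z r) \<and> hcircle Z r \<subseteq> convex hull {A, B, C}"

definition angle_region :: "point \<Rightarrow> point \<Rightarrow> point \<Rightarrow> point set" where
  "angle_region B A C = {A + s *\<^sub>R (B - A) + t *\<^sub>R (C - A) | s t. 0 \<le> s \<and> 0 \<le> t} \<inter> hplane"

text \<open>The side of the line \<open>BC\<close> not containing \<open>A\<close>, the line itself included.\<close>

definition opposite_side :: "point \<Rightarrow> point \<Rightarrow> point \<Rightarrow> point set" where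
  "opposite_side A B C = {X \<in> hplane. closed_segment A X \<inter> hline B C \<noteq> {}}"

text \<open>The escribed circle opposite the first vertex.\<close>

definition escribed_circle :: "point \<Rightarrow> point \<Rightarrow> point \<Rightarrow> point set \<Rightarrow> bool" where
  "escribed_circle A B C \<Gamma> \<longleftrightarrow>
     generalized_circle \<Gamma> \<and> tangent_to_sidelines A B C \<Gamma> \<and>
     \<Gamma> \<subseteq> angle_region B A C \<inter> opposite_side A B C"

text \<open>Metric circles do arise as plane sections in the above sense.\<close>

lemma norm_hplane: "X \<in> hplane \<Longrightarrow> 0 < 1 - (norm X)\<^sup>2"
  by (simp add: hplane_def abs_square_less_1)

lemma sqrt_le_one_minus_inner:
  assumes "X \<in> hplane" "Y \<in> hplane"
  shows "sqrt (1 - (norm X)\<^sup>2) * sqrt (1 - (norm Y)\<^sup>2) \<le> 1 - X \<bullet> Y"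
proof -
  have "2 * (sqrt (1 - (norm X)\<^sup>2) * sqrt (1 - (norm Y)\<^sup>2)) \<le> (1 - (norm X)\<^sup>2) + (1 - (norm Y)\<^sup>2)"
    using sum_squares_bound[of "sqrt (1 - (norm X)\<^sup>2)" "sqrt (1 - (norm Y)\<^sup>2)"]
      norm_hplane[OF assms(1)] norm_hplane[OF assms(2)] by simp
  moreover have "2 * (X \<bullet> Y) \<le> (norm X)\<^sup>2 + (norm Y)\<^sup>2"
    using inner_ge_zero[of "X - Y"]
    by (simp add: inner_diff_left inner_diff_right power2_norm_eq_inner inner_commute)
  ultimately show ?thesis by simp
qed

lemma hcircle_plane_section:
  assumes "Z \<in> hplane" "0 \<le> r"
  defines "k \<equiv> 1 / (cosh r * sqrt (1 - (norm Z)\<^sup>2))"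
  shows "hcircle Z r = {X \<in> hplane. sqrt (1 - (norm X)\<^sup>2) = k - (k *\<^sub>R Z) \<bullet> X}"
proof -
  have "hdist Z X = r \<longleftrightarrow> sqrt (1 - (norm X)\<^sup>2) = k - (k *\<^sub>R Z) \<bullet> X" if X: "X \<in> hplane" for X
  proof -
    define v where "v = (1 - Z \<bullet> X) / (sqrt (1 - (norm Z)\<^sup>2) * sqrt (1 - (norm X)\<^sup>2))"
    have pos: "0 < sqrt (1 - (norm Z)\<^sup>2)" "0 < sqrt (1 - (norm X)\<^sup>2)"
      using norm_hplane[OF assms(1)] norm_hplane[OF X] by simp_all
    have "1 \<le> v"
      using sqrt_le_one_minus_inner[OF assms(1) X] pos by (simp add: v_def)
    then have "hdist Z X = r \<longleftrightarrow> v = cosh r"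
      unfolding hdist_def v_def[symmetric] using assms(2)
      by (metis arcosh_cosh_real cosh_arcosh_real)
    also have "\<dots> \<longleftrightarrow> sqrt (1 - (norm X)\<^sup>2) = k - (k *\<^sub>R Z) \<bullet> X"
      using pos cosh_real_pos[of r] by (auto simp: v_def k_def field_simps)
    finally show ?thesis .
  qed
  then show ?thesis by (auto simp: hcircle_def)
qed

end

theory Submission
  imports Defs
begin

text \<open>
  In the hyperboloid model a circle is a section \<open>\<langle>N, x\<rangle> = 1\<close>; put \<open>s = sqrt (1 - \<langle>N, N\<rangle>)\<close>. A line
  with unit normal \<open>n\<close> touches it at \<open>T\<close> iff \<open>N = T \<plusminus> s n\<close>. So the circle touching the three
  sidelines with given signs is determined, after scaling, by \<open>\<langle>n\<^sub>i, N / s\<rangle> = \<plusminus>1\<close>, and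
  the vector \<open>N / s\<close> of the incircle minus that of the excircle opposite \<open>A\<close> is a positive multiple
  of \<open>A\<close>. If circles \<open>E\<close>, \<open>N\<close> touch at \<open>F\<close>, then \<open>F\<close> is a multiple of \<open>E / s\<^sub>E - N / s\<^sub>N\<close> or of
  \<open>E / s\<^sub>E + N / s\<^sub>N\<close>, according as the contact is internal or external. Let \<open>E\<close> be the Euler circle. With
  internal contact at the incircle and external contact at the excircles, the vector
  \<open>E / s\<^sub>E + N / s\<^sub>N\<close>, with \<open>N\<close> the incircle, is a combination of \<open>F\<close> and \<open>I\<close>, and for each vertex also
  one of the vertex and the corresponding contact point; it represents the common point.

  The kinds of contact follow from convexity, as the Euler circle meets each side in an
  interior point. The area bisection serves only to place the feet in the interior of the sides.
\<close>

section \<open>The Lorentz form and the hyperboloid over the disc\<close>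

definition lor :: "real \<times> point \<Rightarrow> real \<times> point \<Rightarrow> real" where
  "lor p q = fst p * fst q - snd p \<bullet> snd q"

lemma lor_commute: "lor p q = lor q p"
  by (simp add: lor_def inner_commute mult.commute)

lemma lor_linear [simp]:
  "lor (p + q) z = lor p z + lor q z" "lor z (p + q) = lor z p + lor z q"
  "lor (p - q) z = lor p z - lor q z" "lor z (p - q) = lor z p - lor z q"
  "lor (k *\<^sub>R p) z = k * lor p z" "lor z (k *\<^sub>R p) = k * lor z p"
  "lor (- p) z = - lor p z" "lor z (- p) = - lor z p"
  by (simp_all add: lor_def algebra_simps inner_add_left inner_add_right)

text \<open>The reciprocal of the time coordinate of the hyperboloid point over \<open>X\<close>,
  and also the Lorentz length of \<open>(1, X)\<close>.\<close>

definition wgt :: "point \<Rightarrow> real" where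
  "wgt X = sqrt (1 - (norm X)\<^sup>2)"

text \<open>This representative is affine in \<open>X\<close> and so serves the convexity arguments;
  the unit representative \<open>hyp\<close> serves the metric ones.\<close>

definition hom :: "point \<Rightarrow> real \<times> point" where
  "hom X = (1, X)"

text \<open>The point of the hyperboloid above a point of the disc.\<close>

definition hyp :: "point \<Rightarrow> real \<times> point" where
  "hyp X = (1 / wgt X) *\<^sub>R hom X"

lemma wgt_pos: "X \<in> hplane \<Longrightarrow> 0 < wgt X"
  using norm_hplane by (simp add: wgt_def)

lemma wgt_power2: "X \<in> hplane \<Longrightarrow> (wgt X)\<^sup>2 = 1 - (norm X)\<^sup>2"
  using norm_hplane[of X] by (simp add: wgt_def)

lemma lor_hom: "lor (hom X) (hom Y) = 1 - X \<bullet> Y"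
  by (simp add: lor_def hom_def)

lemma hom_hyp: "X \<in> hplane \<Longrightarrow> hom X = wgt X *\<^sub>R hyp X"
  using wgt_pos[of X] by (simp add: hyp_def)

lemma hom_affine:
  "hom ((1 - t) *\<^sub>R X + t *\<^sub>R Y) = (1 - t) *\<^sub>R hom X + t *\<^sub>R hom Y"
  by (simp add: hom_def)

lemma hom_affine3:
  "x + y + z = 1 \<Longrightarrow>
    hom (x *\<^sub>R X + y *\<^sub>R Y + z *\<^sub>R Z) = x *\<^sub>R hom X + y *\<^sub>R hom Y + z *\<^sub>R hom Z"
  by (simp add: hom_def)

text \<open>The left side is \<open>cosh\<close> of the distance minus 1, up to a positive factor.
  The sum of squares gives both its strict positivity and the quadratic estimate behind
  \<open>tangent_normal\<close>.\<close>

lemma one_minus_inner: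
  assumes "X \<in> hplane" "Y \<in> hplane"
  shows "2 * (1 - X \<bullet> Y - wgt X * wgt Y) = (dist X Y)\<^sup>2 + (wgt X - wgt Y)\<^sup>2"
proof -
  have "(dist X Y)\<^sup>2 = (norm X)\<^sup>2 - 2 * (X \<bullet> Y) + (norm Y)\<^sup>2"
    by (simp add: dist_norm power2_norm_eq_inner inner_diff_left inner_diff_right inner_commute)
  then show ?thesis
    using wgt_power2[OF assms(1)] wgt_power2[OF assms(2)] by (simp add: power2_diff)
qed

lemma lor_hyp_self: "X \<in> hplane \<Longrightarrow> lor (hyp X) (hyp X) = 1"
  using one_minus_inner[of X X] wgt_pos[of X] by (simp add: hyp_def lor_hom divide_simps)

lemma lor_hyp: "lor (hyp X) (hyp Y) = (1 - X \<bullet> Y) / (wgt X * wgt Y)"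
  by (simp add: hyp_def lor_hom)

lemma lor_hyp_gt:
  assumes "X \<in> hplane" "Y \<in> hplane" "X \<noteq> Y"
  shows "1 < lor (hyp X) (hyp Y)"
proof -
  have "0 < (dist X Y)\<^sup>2 + (wgt X - wgt Y)\<^sup>2"
    using assms(3) by (intro add_pos_nonneg) auto
  then have "wgt X * wgt Y < 1 - X \<bullet> Y"
    using one_minus_inner[OF assms(1,2)] by simp
  then show ?thesis
    using wgt_pos assms(1,2) by (simp add: lor_hyp)
qed

lemma lor_hyp_ge:
  assumes "X \<in> hplane" "Y \<in> hplane"
  shows "1 \<le> lor (hyp X) (hyp Y)"
  using lor_hyp_gt[OF assms] lor_hyp_self[OF assms(1)] by (cases "X = Y") auto

section \<open>Circles as plane sections\<close>

text \<open>A plane missing the origin can be normalised to the value 1; \<open>N\<close> is then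
  its Lorentz pole.\<close>

definition psection :: "real \<times> point \<Rightarrow> point set" where
  "psection N = {X \<in> hplane. lor N (hyp X) = 1}"

lemma lor_hyp_eq_1_iff: "X \<in> hplane \<Longrightarrow> lor N (hyp X) = 1 \<longleftrightarrow> wgt X = lor N (hom X)"
  using wgt_pos[of X] by (auto simp: hyp_def divide_simps)

lemma lor_hyp_le_1_iff: "X \<in> hplane \<Longrightarrow> lor N (hyp X) \<le> 1 \<longleftrightarrow> lor N (hom X) \<le> wgt X"
  using wgt_pos[of X] by (auto simp: hyp_def divide_simps)

lemma psection_eq: "psection (c, n) = {X \<in> hplane. sqrt (1 - (norm X)\<^sup>2) = c - n \<bullet> X}"
  using lor_hyp_eq_1_iff by (auto simp: psection_def wgt_def[symmetric] lor_def hom_def)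

lemma generalized_circle_psection: "generalized_circle \<Gamma> \<Longrightarrow> \<exists>N. \<Gamma> = psection N"
  unfolding generalized_circle_def psection_eq[symmetric] by blast

text \<open>The pole of a metric circle lies over its center; this is how the incenter enters the
  final linear relation.\<close>

lemma hcircle_psection:
  assumes "Z \<in> hplane" "0 \<le> r"
  shows "\<exists>k>0. hcircle Z r = psection (k *\<^sub>R hom Z)"
proof -
  have "0 < 1 / (cosh r * sqrt (1 - (norm Z)\<^sup>2))"
    using norm_hplane[OF assms(1)] cosh_real_pos[of r] by simp
  then show ?thesis
    unfolding hcircle_plane_section[OF assms]
    by (intro exI[of _ "1 / (cosh r * sqrt (1 - (norm Z)\<^sup>2))"]) (simp add: hom_def psection_eq)
qed

section \<open>Normals of lines and tangency\<close>

text \<open>Turning \<open>Q - P\<close> by a right angle gives the spatial part. As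
  \<open>P\<close> lies in the open disc, Cauchy-Schwarz makes the resulting vector spacelike, so it
  can be scaled to -1.\<close>

lemma line_normal_exists:
  assumes "P \<in> hplane" "P \<noteq> Q"
  shows "\<exists>n. lor n n = -1 \<and> lor n (hom P) = 0 \<and> lor n (hom Q) = 0"
proof -
  define v :: point where "v = vector [- (Q - P) $ 2, (Q - P) $ 1]"
  define m where "m = (v \<bullet> P, v)"
  have vQ: "v \<bullet> (Q - P) = 0"
    by (simp add: v_def inner_vec_def sum_2 algebra_simps)
  have "v \<noteq> 0"
    using assms(2) by (auto simp: v_def vec_eq_iff forall_2)
  have "\<bar>v \<bullet> P\<bar> \<le> norm v * norm P" by (rule Cauchy_Schwarz_ineq2)
  also have "\<dots> < norm v"
    using assms(1) \<open>v \<noteq> 0\<close> by (simp add: hplane_def)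
  finally have "(v \<bullet> P)\<^sup>2 < (norm v)\<^sup>2"
    using power_strict_mono[of "\<bar>v \<bullet> P\<bar>" "norm v" 2] by simp
  then have neg: "lor m m < 0"
    by (simp add: m_def lor_def power2_norm_eq_inner) (simp add: power2_eq_square)
  let ?n = "(1 / sqrt (- lor m m)) *\<^sub>R m"
  have "lor ?n ?n = -1"
    using neg by (simp add: divide_simps)
  moreover have "lor m (hom P) = 0" "lor m (hom Q) = 0"
    using vQ by (simp_all add: m_def lor_def hom_def inner_diff_right)
  ultimately show ?thesis by (intro exI[of _ ?n]) simp
qed

lemma lor_hline:
  assumes "lor n (hom P) = 0" "lor n (hom Q) = 0" "X \<in> hline P Q"
  shows "lor n (hom X) = 0"
proof -
  obtain a b where ab: "X = a *\<^sub>R P + b *\<^sub>R Q" "a + b = 1"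
    using assms(3) by (auto simp: hline_def affine_hull_2)
  then have "hom X = a *\<^sub>R hom P + b *\<^sub>R hom Q" by (simp add: hom_def)
  then show ?thesis using assms(1,2) by simp
qed

text \<open>The affine function \<open>lor n (hom X)\<close> has gradient \<open>- snd n\<close> and
  vanishes on \<open>l\<close>. The bound turns the limit in the definition of tangency into an
  estimate on \<open>n\<close>.\<close>

lemma infdist_line_ge:
  assumes "l \<noteq> {}" "\<And>Y. Y \<in> l \<Longrightarrow> lor n (hom Y) = 0"
  shows "\<bar>lor n (hom X)\<bar> \<le> norm (snd n) * infdist X l"
proof -
  have *: "\<bar>lor n (hom X)\<bar> \<le> norm (snd n) * dist X Y" if "Y \<in> l" for Y
  proof -
    have "lor n (hom X) = lor n (hom X) - lor n (hom Y)" using assms(2)[OF that] by simp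
    also have "\<dots> = - (snd n \<bullet> (X - Y))"
      by (simp add: lor_def hom_def inner_diff_right)
    finally show ?thesis
      using Cauchy_Schwarz_ineq2[of "snd n" "X - Y"] by (simp add: dist_norm)
  qed
  show ?thesis
  proof (cases "snd n = 0")
    case True
    then show ?thesis using * assms(1) by fastforce
  next
    case False
    then have "\<bar>lor n (hom X)\<bar> / norm (snd n) \<le> infdist X l"
      unfolding infdist_notempty[OF assms(1)]
      using assms(1) * by (intro cINF_greatest) (auto simp: divide_simps mult.commute)
    then show ?thesis using False by (simp add: divide_simps mult.commute)
  qed
qed

text \<open>Cramer's rule recovers \<open>y\<close> from \<open>v \<bullet> y\<close> and
  \<open>g \<bullet> y\<close>. If both are small compared with \<open>norm y\<close>, the
  determinant must be small.\<close>

lemma det_bound: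
  fixes v g y :: point
  shows "\<bar>v $ 1 * g $ 2 - v $ 2 * g $ 1\<bar> * norm y \<le> \<bar>v \<bullet> y\<bar> * norm g + \<bar>g \<bullet> y\<bar> * norm v"
proof -
  let ?d = "v $ 1 * g $ 2 - v $ 2 * g $ 1"
  define g' v' :: point where "g' = vector [g $ 2, - g $ 1]" and "v' = vector [v $ 2, - v $ 1]"
  have "?d *\<^sub>R y = (v \<bullet> y) *\<^sub>R g' - (g \<bullet> y) *\<^sub>R v'"
    by (simp add: vec_eq_iff forall_2 g'_def v'_def inner_vec_def sum_2 algebra_simps)
  then have "\<bar>?d\<bar> * norm y = norm ((v \<bullet> y) *\<^sub>R g' - (g \<bullet> y) *\<^sub>R v')"
    by (metis norm_scaleR)
  also have "\<dots> \<le> \<bar>v \<bullet> y\<bar> * norm g' + \<bar>g \<bullet> y\<bar> * norm v'"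
    using norm_triangle_ineq4[of "(v \<bullet> y) *\<^sub>R g'" "(g \<bullet> y) *\<^sub>R v'"] by simp
  finally show ?thesis
    by (simp add: g'_def v'_def norm_vec_def L2_set_def sum_2 add.commute)
qed

lemma parallel_2D:
  fixes v g :: point
  assumes "v $ 1 * g $ 2 - v $ 2 * g $ 1 = 0" "v \<noteq> 0"
  shows "\<exists>k. g = k *\<^sub>R v"
proof -
  have "v $ 1 \<noteq> 0 \<or> v $ 2 \<noteq> 0" using assms(2) by (auto simp: vec_eq_iff forall_2)
  then show ?thesis
  proof
    assume "v $ 1 \<noteq> 0"
    then show ?thesis using assms(1)
      by (intro exI[of _ "g $ 1 / v $ 1"]) (auto simp: vec_eq_iff forall_2 field_simps)
  next
    assume "v $ 2 \<noteq> 0"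
    then show ?thesis using assms(1)
      by (intro exI[of _ "g $ 2 / v $ 2"]) (auto simp: vec_eq_iff forall_2 field_simps)
  qed
qed

text \<open>Both \<open>N - hyp T\<close> and \<open>n\<close> vanish at \<open>T\<close>, so it suffices that their spatial parts are
  parallel. Along the section the first is quadratically small in \<open>dist X T\<close>, the
  second is \<open>o (dist X T)\<close> by tangency, and two independent covectors cannot both be \<open>o (dist X T)\<close>.\<close>

lemma tangent_normal:
  assumes tan: "tangent_line_at (hline P Q) (psection N) T"
    and n: "lor n n = -1" "lor n (hom P) = 0" "lor n (hom Q) = 0"
  shows "\<exists>k. N = hyp T + k *\<^sub>R n"
proof -
  let ?l = "hline P Q" and ?G = "psection N"
  define g where "g = snd N - (1 / wgt T) *\<^sub>R T"
  have T: "T \<in> ?l" "T \<in> ?G" "T islimpt ?G" "T \<in> hplane" "lor N (hyp T) = 1"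
    and lim: "((\<lambda>X. infdist X ?l / dist X T) \<longlongrightarrow> 0) (at T within ?G)"
    using tan by (auto simp: tangent_line_at_def psection_def)
  have nT: "lor n (hom T) = 0" using lor_hline n(2,3) T(1) by blast
  define M where "M = N - hyp T"
  have MT: "lor M (hom T) = 0"
    using T(5) lor_hyp_self[OF T(4)] wgt_pos[OF T(4)]
    by (simp add: M_def hom_hyp[OF T(4)])
  have gM: "snd M = g" by (simp add: M_def g_def hyp_def hom_def)
  have M_eq: "M = (g \<bullet> T, g)"
    using MT gM by (simp add: prod_eq_iff lor_def hom_def)
  have diff: "lor m (hom X) = - (snd m \<bullet> (X - T))" if "lor m (hom T) = 0" for m X
    using that by (simp add: lor_def hom_def inner_diff_right)
  \<comment> \<open>On the section \<open>wgt\<close> equals the affine function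
    \<open>lor N (hom X)\<close>, so it changes by at most \<open>norm (snd N) * dist X T\<close>.
    Inserting this into \<open>one_minus_inner\<close> gives \<open>K\<close>.\<close>
  define K where "K = (1 + (norm (snd N))\<^sup>2) / (2 * wgt T)"
  have quad: "\<bar>g \<bullet> (X - T)\<bar> \<le> K * (dist X T)\<^sup>2" if X: "X \<in> ?G" for X
  proof -
    have Xh: "X \<in> hplane" and NX: "lor N (hom X) = wgt X"
      using X lor_hyp_eq_1_iff[of X N] by (auto simp: psection_def)
    have NT: "lor N (hom T) = wgt T" using lor_hyp_eq_1_iff[of T N] T by simp
    have "g \<bullet> (X - T) = - lor M (hom X)" using diff[OF MT, of X] gM by simp
    also have "\<dots> = lor (hyp T) (hom X) - wgt X" by (simp add: M_def NX)
    also have "lor (hyp T) (hom X) = (1 - X \<bullet> T) / wgt T"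
      by (simp add: hyp_def lor_hom inner_commute)
    also have "\<dots> - wgt X = (2 * (1 - X \<bullet> T - wgt X * wgt T)) / (2 * wgt T)"
      using wgt_pos[OF T(4)] by (simp add: field_simps)
    also have "\<dots> = ((dist X T)\<^sup>2 + (wgt X - wgt T)\<^sup>2) / (2 * wgt T)"
      by (simp only: one_minus_inner[OF Xh T(4)])
    finally have eq: "g \<bullet> (X - T) = ((dist X T)\<^sup>2 + (wgt X - wgt T)\<^sup>2) / (2 * wgt T)" .
    have "wgt X - wgt T = - (snd N \<bullet> (X - T))"
      using NX NT by (simp add: lor_def hom_def inner_diff_right)
    then have "\<bar>wgt X - wgt T\<bar> \<le> norm (snd N) * dist X T"
      using Cauchy_Schwarz_ineq2[of "snd N" "X - T"] by (simp add: dist_norm)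
    then have "(wgt X - wgt T)\<^sup>2 \<le> (norm (snd N) * dist X T)\<^sup>2"
      using power_mono[of "\<bar>wgt X - wgt T\<bar>" "norm (snd N) * dist X T" 2] by simp
    then show ?thesis
      unfolding eq using wgt_pos[OF T(4)]
      by (simp add: K_def field_simps power_mult_distrib)
  qed
  let ?v = "snd n"
  let ?d = "\<bar>?v $ 1 * g $ 2 - ?v $ 2 * g $ 1\<bar>"
  let ?f = "\<lambda>X. norm ?v * (infdist X ?l / dist X T) * norm g + K * dist X T * norm ?v"
  \<comment> \<open>The constant \<open>?d\<close> is dominated by \<open>?f\<close>, which tends to
    0 along the section; \<open>T\<close> being a limit point makes this limit meaningful.\<close>
  have "?d \<le> 0"
  proof (rule tendsto_lowerbound)
    have "((\<lambda>X. dist X T) \<longlongrightarrow> 0) (at T within ?G)"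
      using tendsto_dist[OF tendsto_ident_at[of T ?G] tendsto_const[of T]] by simp
    from tendsto_add[OF tendsto_mult_left_zero[OF tendsto_mult_right_zero[OF lim]]
        tendsto_mult_left_zero[OF tendsto_mult_right_zero[OF this]]]
    show "(?f \<longlongrightarrow> 0) (at T within ?G)"
      by simp
    show "\<forall>\<^sub>F X in at T within ?G. ?d \<le> ?f X"
    proof (unfold eventually_at_filter, intro always_eventually allI impI)
      fix X assume "X \<noteq> T" "X \<in> ?G"
      then have pos: "0 < dist X T" by simp
      have 1: "\<bar>?v \<bullet> (X - T)\<bar> \<le> norm ?v * infdist X ?l"
        using infdist_line_ge[of ?l n X] T(1) lor_hline[OF n(2,3)] diff[OF nT, of X] by auto
      have "?d * dist X T \<le> \<bar>?v \<bullet> (X - T)\<bar> * norm g + \<bar>g \<bullet> (X - T)\<bar> * norm ?v"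
        using det_bound[of ?v g "X - T"] by (simp add: dist_norm)
      also have "\<dots> \<le> norm ?v * infdist X ?l * norm g + K * (dist X T)\<^sup>2 * norm ?v"
        using 1 quad[OF \<open>X \<in> ?G\<close>] by (intro add_mono mult_right_mono) auto
      also have "\<dots> = ?f X * dist X T"
        using pos by (simp add: field_simps power2_eq_square)
      finally show "?d \<le> ?f X" using pos by simp
    qed
    show "at T within ?G \<noteq> bot" using T(3) trivial_limit_within by blast
  qed
  then have "?v $ 1 * g $ 2 - ?v $ 2 * g $ 1 = 0" by simp
  moreover have "?v \<noteq> 0"
  proof
    assume "?v = 0"
    then have "lor n n = (fst n)\<^sup>2" by (simp add: lor_def power2_eq_square)
    then show False using n(1) zero_le_power2[of "fst n"] by linarith
  qed
  ultimately obtain k where k: "g = k *\<^sub>R ?v" using parallel_2D by blast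
  have "fst n = ?v \<bullet> T" using nT by (simp add: lor_def hom_def)
  then have "M = k *\<^sub>R n" using M_eq k by (simp add: prod_eq_iff)
  then show ?thesis by (intro exI[of _ k]) (simp add: M_def algebra_simps)
qed

section \<open>Area and the position of the bisecting feet\<close>

lemma convex_hull_hplane:
  assumes "A \<in> hplane" "B \<in> hplane" "C \<in> hplane"
  shows "convex hull {A, B, C} \<subseteq> hplane"
  using assms by (intro hull_minimal) (auto simp: hplane_def)

lemma harea_degenerate:
  assumes "collinear {A, B, C}"
  shows "harea (convex hull {A, B, C}) = 0"
proof -
  have "aff_dim (convex hull {A, B, C}) < int DIM(point)"
    using assms by (simp add: aff_dim_convex_hull collinear_aff_dim)
  then have "negligible (convex hull {A, B, C})" 
    using aff_dim_nonempty_interior negligible_convex_interior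
    by (metis convex_convex_hull less_irrefl)
  then show ?thesis
    unfolding harea_def by (intro integral_unique has_integral_negligible) auto
qed

text \<open>The density is at least 1, so the area dominates the Lebesgue measure of a set with
  interior. Integrability holds because the triangle is compact inside the open disc.\<close>

lemma harea_pos:
  assumes "htriangle A B C"
  shows "0 < harea (convex hull {A, B, C})"
proof -
  let ?S = "convex hull {A, B, C}" and ?f = "\<lambda>X::point. (1 - (norm X)\<^sup>2) powr (- 3 / 2)"
  have ABC: "A \<in> hplane" "B \<in> hplane" "C \<in> hplane" "\<not> collinear {A, B, C}"
    using assms by (auto simp: htriangle_def)
  have comp: "compact ?S" by (simp add: finite_imp_compact_convex_hull)
  have pos: "0 < 1 - (norm X)\<^sup>2" if "X \<in> ?S" for X
    using norm_hplane convex_hull_hplane[OF ABC(1-3)] that by blast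
  have cont: "continuous_on ?S ?f"
    by (intro continuous_intros) (use pos in force)
  have int: "?f integrable_on ?S"
    using borel_integrable_compact[OF comp cont]
    by (intro set_borel_integral_eq_integral(1)) (simp add: set_integrable_def)
  have "card {A, B, C} = 3" "\<not> affine_dependent {A, B, C}"
    using ABC(4) by (auto simp: collinear_3_eq_affine_dependent)
  then have "interior ?S \<noteq> {}"
    using interior_convex_hull_eq_empty[of "{A, B, C}"] by simp
  then have "\<not> negligible ?S"
    by (simp add: negligible_convex_interior)
  moreover have lm: "?S \<in> lmeasurable" using comp by (rule lmeasurable_compact)
  ultimately have "0 < measure lebesgue ?S"
    by (simp add: negligible_iff_measure0 zero_less_measure_iff)
  also have "measure lebesgue ?S = integral ?S (\<lambda>X. 1)" by (rule lmeasure_integral[OF lm])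
  also have "\<dots> \<le> integral ?S ?f"
  proof (rule integral_le)
    show "(\<lambda>X. 1::real) integrable_on ?S" using lm by (simp add: integrable_on_const)
    show "1 \<le> ?f X" if "X \<in> ?S" for X
      using powr_mono2'[of "- 3 / 2" "1 - (norm X)\<^sup>2" 1] pos[OF that] by simp
  qed (rule int)
  finally show ?thesis by (simp add: harea_def)
qed

text \<open>With the foot at a vertex, one of the two parts would be degenerate, of area 0, and the
  other the whole triangle.\<close>

lemma bisecting_foot_open_segment:
  assumes "htriangle A B C" "bisecting_foot A B C M"
  shows "M \<in> open_segment B C"
proof -
  have "M \<noteq> B"
  proof
    assume "M = B"
    moreover have "htriangle A C B" using assms(1) by (simp add: htriangle_def insert_commute)
    ultimately show False
      using assms(2) harea_pos[of A C B] harea_degenerate[of A B B]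
      by (simp add: bisecting_foot_def)
  qed
  moreover have "M \<noteq> C"
    using assms harea_pos[of A B C] harea_degenerate[of A C C]
    by (auto simp: bisecting_foot_def)
  ultimately show ?thesis using assms(2) by (simp add: bisecting_foot_def open_segment_def)
qed

section \<open>Vertices and side normals as bases\<close>

lemma hom_basis:
  assumes "\<not> collinear {A, B, C}"
  shows "\<exists>x y z. p = x *\<^sub>R hom A + y *\<^sub>R hom B + z *\<^sub>R hom C"
proof -
  define D where "D = (B - A) $ 1 * (C - A) $ 2 - (B - A) $ 2 * (C - A) $ 1"
  have "D \<noteq> 0"
  proof
    assume "D = 0"
    moreover have "B - A \<noteq> 0" using assms by auto
    ultimately obtain k where "C - A = k *\<^sub>R (B - A)" using parallel_2D D_def by metis
    then have "C = k *\<^sub>R B + (1 - k) *\<^sub>R A" by (simp add: algebra_simps)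
    then have "collinear {B, C, A}" unfolding collinear_3_expand by blast
    then show False using assms by (simp add: insert_commute)
  qed
  \<comment> \<open>Removing \<open>fst p\<close> times \<open>hom A\<close> leaves a vector without
    time part; Cramer's rule resolves it along \<open>B - A\<close> and
    \<open>C - A\<close>.\<close>
  define q where "q = snd p - fst p *\<^sub>R A"
  define y z where "y = (q $ 1 * (C - A) $ 2 - q $ 2 * (C - A) $ 1) / D"
    and "z = (q $ 2 * (B - A) $ 1 - q $ 1 * (B - A) $ 2) / D"
  have yD: "D * y = q $ 1 * (C - A) $ 2 - q $ 2 * (C - A) $ 1"
    and zD: "D * z = q $ 2 * (B - A) $ 1 - q $ 1 * (B - A) $ 2"
    using \<open>D \<noteq> 0\<close> by (simp_all add: y_def z_def)
  have "D *\<^sub>R q = (D * y) *\<^sub>R (B - A) + (D * z) *\<^sub>R (C - A)"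
    unfolding yD zD by (simp add: D_def vec_eq_iff forall_2 algebra_simps)
  also have "\<dots> = D *\<^sub>R (y *\<^sub>R (B - A) + z *\<^sub>R (C - A))"
    by (simp only: scaleR_add_right scaleR_scaleR)
  finally have "q = y *\<^sub>R (B - A) + z *\<^sub>R (C - A)"
    using \<open>D \<noteq> 0\<close> by (simp only: scaleR_cancel_left) auto
  then have "p = (fst p - y - z) *\<^sub>R hom A + y *\<^sub>R hom B + z *\<^sub>R hom C"
    by (simp add: q_def hom_def prod_eq_iff algebra_simps)
  then show ?thesis by blast
qed

text \<open>With normals pointing inward, the incircle has the signs +, +, + and the excircle
  opposite \<open>A\<close> has -, +, +. The cyclic form lets each fact be proved for one vertex or
  side only.\<close>

definition side_normals ::
    "point \<Rightarrow> point \<Rightarrow> point \<Rightarrow> real \<times> point \<Rightarrow> real \<times> point \<Rightarrow> real \<times> point \<Rightarrow> bool" where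
  "side_normals A B C u v w \<longleftrightarrow> htriangle A B C \<and>
     lor u u = -1 \<and> lor v v = -1 \<and> lor w w = -1 \<and>
     0 < lor u (hom A) \<and> lor u (hom B) = 0 \<and> lor u (hom C) = 0 \<and>
     0 < lor v (hom B) \<and> lor v (hom C) = 0 \<and> lor v (hom A) = 0 \<and>
     0 < lor w (hom C) \<and> lor w (hom A) = 0 \<and> lor w (hom B) = 0"

lemma htriangle_rotate: "htriangle A B C \<Longrightarrow> htriangle B C A"
  by (simp add: htriangle_def insert_commute)

lemma side_normals_rotate: "side_normals A B C u v w \<Longrightarrow> side_normals B C A v w u"
  by (simp add: side_normals_def htriangle_rotate)

lemma side_normal_exists:
  assumes "htriangle A B C"
  shows "\<exists>n. lor n n = -1 \<and> 0 < lor n (hom A) \<and> lor n (hom B) = 0 \<and> lor n (hom C) = 0"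
proof -
  have ABC: "B \<in> hplane" "\<not> collinear {A, B, C}" using assms by (auto simp: htriangle_def)
  then have "B \<noteq> C" by auto
  with ABC(1) obtain n where n: "lor n n = -1" "lor n (hom B) = 0" "lor n (hom C) = 0"
    using line_normal_exists by blast
  obtain x y z where "n = x *\<^sub>R hom A + y *\<^sub>R hom B + z *\<^sub>R hom C"
    using hom_basis[OF ABC(2)] by blast
  \<comment> \<open>If \<open>n\<close> were also orthogonal to \<open>hom A\<close>, it would be
    orthogonal to itself, against \<open>lor n n = -1\<close>.\<close>
  then have "lor n n = lor n (x *\<^sub>R hom A + y *\<^sub>R hom B + z *\<^sub>R hom C)" by simp
  then have "lor n (hom A) \<noteq> 0" using n by auto
  then consider "0 < lor n (hom A)" | "0 < lor (- n) (hom A)" by fastforce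
  then show ?thesis
  proof cases
    case 1
    then show ?thesis using n by blast
  next
    case 2
    then show ?thesis using n by (intro exI[of _ "- n"]) simp
  qed
qed

lemma side_normals_exist:
  assumes "htriangle A B C"
  shows "\<exists>u v w. side_normals A B C u v w"
  using side_normal_exists[OF assms] side_normal_exists[OF htriangle_rotate[OF assms]]
    side_normal_exists[OF htriangle_rotate[OF htriangle_rotate[OF assms]]] assms
  unfolding side_normals_def by blast

text \<open>Pairing with \<open>u\<close>, \<open>v\<close>, \<open>w\<close> reads off the
  coordinates in the basis of vertices, up to nonzero factors. It is applied to the difference of
  the scaled incircle and excircle vectors.\<close>

lemma orthogonal_to_two_sides:
  assumes "side_normals A B C u v w" "lor v z = 0" "lor w z = 0"
  shows "z = (lor u z / lor u (hom A)) *\<^sub>R hom A"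
proof -
  have s: "\<not> collinear {A, B, C}" "lor u (hom A) \<noteq> 0" "lor v (hom B) \<noteq> 0" "lor w (hom C) \<noteq> 0"
    using assms(1) by (auto simp: side_normals_def htriangle_def)
  obtain a b c where z: "z = a *\<^sub>R hom A + b *\<^sub>R hom B + c *\<^sub>R hom C"
    using hom_basis[OF s(1)] by blast
  have "b = 0" "c = 0"
    using assms s unfolding z by (auto simp: side_normals_def)
  then have "z = a *\<^sub>R hom A" using z by simp
  then show ?thesis using s(2) by simp
qed

section \<open>Normal forms of tangent circles\<close>

text \<open>For a metric circle this is \<open>tanh\<close> of the radius; it is 1 for a horocycle
  and larger than 1 for an equidistant curve.\<close>

definition rad :: "real \<times> point \<Rightarrow> real" where
  "rad N = sqrt (1 - lor N N)"

lemma lor_normal_form: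
  assumes "T \<in> hplane" "lor n n = -1" "lor n (hom T) = 0"
  shows "lor (hyp T + k *\<^sub>R n) (hyp T + k *\<^sub>R n) = 1 - k\<^sup>2"
proof -
  have "lor n (hyp T) = 0" "lor (hyp T) n = 0"
    using assms(3) by (simp_all add: hyp_def lor_commute)
  then show ?thesis
    using lor_hyp_self[OF assms(1)] assms(2) by (simp add: power2_eq_square)
qed

lemma tangent_line_atD:
  assumes "tangent_line_at (hline P Q) \<Gamma> T"
  shows "T \<in> hline P Q" "T \<in> \<Gamma>" "\<exists>X\<in>\<Gamma>. X \<noteq> T" "T \<in> hplane"
  using assms by (auto simp: tangent_line_at_def islimpt_def hline_def)

lemma tangent_normal_rad:
  assumes tan: "tangent_line_at (hline P Q) (psection N) T"
    and n: "lor n n = -1" "lor n (hom P) = 0" "lor n (hom Q) = 0"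
  shows "0 < rad N \<and> (N = hyp T + rad N *\<^sub>R n \<or> N = hyp T - rad N *\<^sub>R n)"
proof -
  obtain k where k: "N = hyp T + k *\<^sub>R n" using tangent_normal[OF assms] by blast
  have T: "T \<in> hplane" "T \<in> psection N" "lor n (hom T) = 0"
    using tangent_line_atD[OF tan] lor_hline[OF n(2,3)] by auto
  obtain X where X: "X \<in> psection N" "X \<noteq> T" using tangent_line_atD[OF tan] by blast
  have rad: "rad N = \<bar>k\<bar>"
    using lor_normal_form[OF T(1) n(1) T(3), of k] by (simp add: rad_def k)
  \<comment> \<open>For \<open>k = 0\<close> the section would reduce to the point \<open>T\<close>,
    whereas a tangent section has a second point.\<close>
  have "k \<noteq> 0"
  proof
    assume "k = 0"
    then have "lor (hyp T) (hyp X) = 1" using X k by (simp add: psection_def)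
    then show False using lor_hyp_gt[of T X] X T(1) by (auto simp: psection_def)
  qed
  then show ?thesis using k rad by (auto simp: abs_if)
qed

text \<open>The side of the line on which the circle lies decides the sign: with a plus, any second
  point \<open>X\<close> of the section would give \<open>lor N (hyp X) > 1\<close>.\<close>

lemma tangent_normal_side:
  assumes tan: "tangent_line_at (hline P Q) (psection N) T"
    and n: "lor n n = -1" "lor n (hom P) = 0" "lor n (hom Q) = 0"
    and side: "\<And>X. X \<in> psection N \<Longrightarrow> 0 \<le> lor n (hom X)"
  shows "0 < rad N" "N = hyp T - rad N *\<^sub>R n" "lor n N = rad N"
proof -
  note * = tangent_normal_rad[OF tan n]
  then show pos: "0 < rad N" by blast
  obtain X where X: "X \<in> psection N" "X \<noteq> T" using tangent_line_atD[OF tan] by blast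
  have T: "T \<in> hplane" "lor n (hom T) = 0"
    using tangent_line_atD[OF tan] lor_hline[OF n(2,3)] by auto
  have "N \<noteq> hyp T + rad N *\<^sub>R n"
  proof
    assume "N = hyp T + rad N *\<^sub>R n"
    then have "lor N (hyp X) = lor (hyp T) (hyp X) + rad N * lor n (hyp X)"
      by (metis lor_linear(1,5))
    moreover have "0 \<le> lor n (hyp X)"
      using side[OF X(1)] wgt_pos[of X] X(1) by (simp add: hyp_def psection_def)
    then have "0 \<le> rad N * lor n (hyp X)" using pos by simp
    moreover have "lor N (hyp X) = 1" "1 < lor (hyp T) (hyp X)"
      using X lor_hyp_gt[OF T(1), of X] by (auto simp: psection_def)
    ultimately show False by linarith
  qed
  with * show N: "N = hyp T - rad N *\<^sub>R n" by blast
  have "lor n N = lor n (hyp T) - rad N * lor n n" by (metis N lor_linear(4,6))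
  then show "lor n N = rad N" using n(1) T(2) by (simp add: hyp_def)
qed

text \<open>The free sign of the normal is spent on giving \<open>E\<close> a plus; the sign left at
  \<open>N\<close> then tells internal (plus) from external (minus) contact.\<close>

lemma point_of_contact_normal:
  assumes "point_of_contact (psection E) (psection N) F"
  shows "F \<in> hplane \<and> 0 < rad E \<and> 0 < rad N \<and>
    (\<exists>n. E = hyp F + rad E *\<^sub>R n \<and> (N = hyp F + rad N *\<^sub>R n \<or> N = hyp F - rad N *\<^sub>R n))"
proof -
  obtain P Q where PQ: "P \<in> hplane" "P \<noteq> Q"
    and tE: "tangent_line_at (hline P Q) (psection E) F"
    and tN: "tangent_line_at (hline P Q) (psection N) F"
    using assms by (auto simp: point_of_contact_def)
  obtain n where n: "lor n n = -1" "lor n (hom P) = 0" "lor n (hom Q) = 0"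
    using line_normal_exists[OF PQ] by blast
  have F: "F \<in> hplane" using tangent_line_atD[OF tE] by blast
  note E = tangent_normal_rad[OF tE n] and N = tangent_normal_rad[OF tN n]
  from E have "E = hyp F + rad E *\<^sub>R n \<or> E = hyp F + rad E *\<^sub>R (- n)" by simp
  then show ?thesis
  proof
    assume "E = hyp F + rad E *\<^sub>R n"
    then show ?thesis using E N F by blast
  next
    assume "E = hyp F + rad E *\<^sub>R (- n)"
    then show ?thesis using E N F by (intro conjI exI[of _ "- n"]) auto
  qed
qed

section \<open>Convexity of the inside of a section\<close>

lemma lor_hyp_lt_hom:
  assumes "X \<in> hplane" "Y \<in> hplane" "X \<noteq> Y"
  shows "wgt X * wgt Y < lor (hom X) (hom Y)"
  using lor_hyp_gt[OF assms] wgt_pos assms(1,2) by (simp add: lor_hom lor_hyp)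

lemma hplane_convex: "convex hplane"
  by (simp add: hplane_def)

lemma convex_combination_hplane:
  assumes "X \<in> hplane" "Y \<in> hplane" "0 \<le> t" "t \<le> 1"
  shows "(1 - t) *\<^sub>R X + t *\<^sub>R Y \<in> hplane"
  using hplane_convex assms by (simp add: convex_alt)

text \<open>This is the strict reversed triangle inequality for the Lorentz lengths of
  \<open>hom X\<close> and \<open>hom Y\<close>, proved by comparing squares.\<close>

lemma wgt_strict_concave:
  assumes XY: "X \<in> hplane" "Y \<in> hplane" "X \<noteq> Y" and t: "0 < t" "t < 1"
  shows "(1 - t) * wgt X + t * wgt Y < wgt ((1 - t) *\<^sub>R X + t *\<^sub>R Y)"
proof -
  let ?Z = "(1 - t) *\<^sub>R X + t *\<^sub>R Y"
  have self: "lor (hom V) (hom V) = (wgt V)\<^sup>2" if "V \<in> hplane" for V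
    using wgt_power2[OF that] by (simp add: lor_hom power2_norm_eq_inner)
  have Z: "?Z \<in> hplane" using convex_combination_hplane XY t by simp
  have "((1 - t) * wgt X + t * wgt Y)\<^sup>2 =
      (1 - t)\<^sup>2 * (wgt X)\<^sup>2 + t\<^sup>2 * (wgt Y)\<^sup>2 + 2 * (1 - t) * t * (wgt X * wgt Y)"
    by (simp add: power2_eq_square algebra_simps)
  also have "\<dots> < (1 - t)\<^sup>2 * (wgt X)\<^sup>2 + t\<^sup>2 * (wgt Y)\<^sup>2 + 2 * (1 - t) * t * lor (hom X) (hom Y)"
    using t lor_hyp_lt_hom[OF XY] by simp
  also have "\<dots> = lor (hom ?Z) (hom ?Z)"
    unfolding hom_affine self[OF XY(1), symmetric] self[OF XY(2), symmetric]
    by (simp add: power2_eq_square algebra_simps lor_commute[of "hom Y" "hom X"])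
  also have "\<dots> = (wgt ?Z)\<^sup>2" by (rule self[OF Z])
  finally show ?thesis using power_less_imp_less_base wgt_pos[OF Z] by fastforce
qed

text \<open>The inside is where an affine function stays below the strictly concave
  \<open>wgt\<close>; this covers circles, horocycles and equidistant curves alike.\<close>

lemma section_interior_strict_convex:
  assumes "X \<in> hplane" "Y \<in> hplane" "X \<noteq> Y" "0 < t" "t < 1"
    "lor N (hom X) \<le> wgt X" "lor N (hom Y) \<le> wgt Y"
  shows "lor N (hom ((1 - t) *\<^sub>R X + t *\<^sub>R Y)) < wgt ((1 - t) *\<^sub>R X + t *\<^sub>R Y)"
proof -
  have "lor N (hom ((1 - t) *\<^sub>R X + t *\<^sub>R Y)) = (1 - t) * lor N (hom X) + t * lor N (hom Y)"
    by (simp only: hom_affine lor_linear)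
  also have "\<dots> \<le> (1 - t) * wgt X + t * wgt Y"
    using assms by (intro add_mono mult_left_mono) auto
  finally show ?thesis using wgt_strict_concave[OF assms(1-5)] by simp
qed

lemma section_interior_convex:
  assumes "X \<in> hplane" "Y \<in> hplane" "0 \<le> t" "t \<le> 1"
    "lor N (hom X) \<le> wgt X" "lor N (hom Y) \<le> wgt Y"
  shows "lor N (hom ((1 - t) *\<^sub>R X + t *\<^sub>R Y)) \<le> wgt ((1 - t) *\<^sub>R X + t *\<^sub>R Y)"
proof (cases "X = Y \<or> t = 0 \<or> t = 1")
  case True
  then show ?thesis using assms by (auto simp: scaleR_left_diff_distrib)
next
  case False
  then show ?thesis using section_interior_strict_convex[of X Y t N] assms by auto
qed

lemma open_segmentE:
  assumes "M \<in> open_segment X Y"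
  obtains t where "0 < t" "t < 1" "M = (1 - t) *\<^sub>R X + t *\<^sub>R Y" "X \<noteq> Y"
  using assms by (auto simp: in_segment)

lemma lor_hyp_nonneg_iff: "X \<in> hplane \<Longrightarrow> 0 \<le> lor n (hyp X) \<longleftrightarrow> 0 \<le> lor n (hom X)"
  using wgt_pos[of X] by (simp add: hyp_def zero_le_divide_iff)

lemma side_normals_hplane:
  "side_normals A B C u v w \<Longrightarrow> A \<in> hplane \<and> B \<in> hplane \<and> C \<in> hplane"
  by (simp add: side_normals_def htriangle_def)

lemma lor_psection_normal:
  assumes "E = hyp F + e *\<^sub>R n" "X \<in> psection E"
  shows "e * lor n (hyp X) = 1 - lor (hyp F) (hyp X)"
proof -
  have "lor E (hyp X) = lor (hyp F) (hyp X) + e * lor n (hyp X)" by (simp add: assms(1))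
  then show ?thesis using assms(2) by (simp add: psection_def)
qed

section \<open>Kinds of contact with the Euler circle\<close>

text \<open>Comparing the two expressions for \<open>N\<close> at \<open>A\<close> and
  \<open>B\<close>, and hence at \<open>T\<close> between them, gives
  \<open>lor (hyp F) (hyp T) \<le> 1\<close>. So \<open>F = T\<close> and \<open>n = - w\<close>,
  which is negative at a point \<open>M\<close> off the line \<open>AB\<close> on the side of
  \<open>C\<close>.\<close>

lemma incircle_tangent_at_side:
  assumes S: "side_normals A B C u v w"
    and F: "F \<in> hplane" and s: "0 < s" and N: "N = hyp F + s *\<^sub>R n"
    and T: "T \<in> closed_segment A B" "N = hyp T - s *\<^sub>R w"
    and AB: "0 \<le> lor n (hom A)" "0 \<le> lor n (hom B)"
    and M: "M \<in> open_segment B C" "0 \<le> lor n (hom M)"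
  shows False
proof -
  note h = side_normals_hplane[OF S]
  obtain t where t: "0 \<le> t" "t \<le> 1" "T = (1 - t) *\<^sub>R A + t *\<^sub>R B"
    using T(1) by (auto simp: in_segment)
  then have Th: "T \<in> hplane" using convex_combination_hplane h by blast
  have le: "lor (hyp F) (hom X) \<le> lor (hyp T) (hom X)"
    if "0 \<le> lor n (hom X)" "lor w (hom X) = 0" for X
  proof -
    have "lor (hyp F) (hom X) + s * lor n (hom X) = lor (hyp T) (hom X)"
      using arg_cong[OF trans[OF N[symmetric] T(2)], of "\<lambda>p. lor p (hom X)"] that(2) by simp
    moreover have "0 \<le> s * lor n (hom X)" using s that(1) by simp
    ultimately show ?thesis by linarith
  qed
  have homT: "hom T = (1 - t) *\<^sub>R hom A + t *\<^sub>R hom B" using hom_affine t(3) by simp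
  have "lor (hyp F) (hom T) \<le> lor (hyp T) (hom T)"
    unfolding homT lor_linear using le AB t S
    by (intro add_mono mult_left_mono) (auto simp: side_normals_def)
  then have "wgt T * lor (hyp F) (hyp T) \<le> wgt T * lor (hyp T) (hyp T)"
    unfolding hom_hyp[OF Th] lor_linear .
  then have "lor (hyp F) (hyp T) \<le> 1"
    using wgt_pos[OF Th] lor_hyp_self[OF Th] by simp
  then have "F = T" using lor_hyp_gt[OF F Th] by fastforce
  then have "s *\<^sub>R n = s *\<^sub>R (- w)" using N T(2) by simp
  then have n: "n = - w" using s by (simp only: scaleR_cancel_left) simp
  obtain m where m: "0 < m" "M = (1 - m) *\<^sub>R B + m *\<^sub>R C"
    using M(1) by (rule open_segmentE)
  then have "lor n (hom M) = - (m * lor w (hom C))"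
    using S by (simp add: n hom_affine side_normals_def)
  moreover have "0 < m * lor w (hom C)" using m(1) S by (simp add: side_normals_def)
  ultimately show False using M(2) by simp
qed

text \<open>An externally tangent circle would lie beyond the common tangent line. As it meets all three
  sides, two vertices would lie there too, which forces that line to be the side joining them.\<close>

lemma incircle_not_externally_tangent:
  assumes S: "side_normals A B C u v w"
    and F: "F \<in> hplane" and s: "0 < s" "0 < e"
    and N: "N = hyp F + s *\<^sub>R n" and E: "E = hyp F - e *\<^sub>R n"
    and Ta: "Ta \<in> closed_segment B C" "N = hyp Ta - s *\<^sub>R u"
    and Tb: "Tb \<in> closed_segment C A" "N = hyp Tb - s *\<^sub>R v"
    and Tc: "Tc \<in> closed_segment A B" "N = hyp Tc - s *\<^sub>R w"
    and Ma: "Ma \<in> open_segment B C" "Ma \<in> psection E"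
    and Mb: "Mb \<in> open_segment C A" "Mb \<in> psection E"
    and Mc: "Mc \<in> open_segment A B" "Mc \<in> psection E"
  shows False
proof -
  have nonneg: "0 \<le> lor n (hom M)" if M: "M \<in> psection E" for M
  proof -
    have Mh: "M \<in> hplane" using M by (simp add: psection_def)
    have "- e * lor n (hyp M) = 1 - lor (hyp F) (hyp M)"
      using E M by (intro lor_psection_normal) simp_all
    then have "0 \<le> e * lor n (hyp M)" using lor_hyp_ge[OF F Mh] by simp
    then show ?thesis using s(2) lor_hyp_nonneg_iff[OF Mh] by (simp add: zero_le_mult_iff)
  qed
  have endpoint: "0 \<le> lor n (hom X) \<or> 0 \<le> lor n (hom Y)"
    if M: "M \<in> open_segment X Y" "M \<in> psection E" for M X Y
  proof (rule ccontr)
    assume *: "\<not> ?thesis"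
    obtain t where t: "0 < t" "t < 1" "M = (1 - t) *\<^sub>R X + t *\<^sub>R Y"
      using M(1) by (rule open_segmentE)
    then have "lor n (hom M) = (1 - t) * lor n (hom X) + t * lor n (hom Y)"
      by (simp add: hom_affine)
    moreover have "(1 - t) * lor n (hom X) < 0" "t * lor n (hom Y) < 0"
      using * t by (auto intro!: mult_pos_neg)
    ultimately show False using nonneg[OF M(2)] by linarith
  qed
  note S' = side_normals_rotate[OF S]
  note S'' = side_normals_rotate[OF S']
  consider "0 \<le> lor n (hom A)" "0 \<le> lor n (hom B)" | "0 \<le> lor n (hom B)" "0 \<le> lor n (hom C)"
    | "0 \<le> lor n (hom C)" "0 \<le> lor n (hom A)"
    using endpoint[OF Ma] endpoint[OF Mb] endpoint[OF Mc] by blast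
  then show False
  proof cases
    case 1
    then show False
      using incircle_tangent_at_side[OF S F s(1) N Tc _ _ Ma(1) nonneg[OF Ma(2)]] by blast
  next
    case 2
    then show False
      using incircle_tangent_at_side[OF S' F s(1) N Ta _ _ Mb(1) nonneg[OF Mb(2)]] by blast
  next
    case 3
    then show False
      using incircle_tangent_at_side[OF S'' F s(1) N Tb _ _ Mc(1) nonneg[OF Mc(2)]] by blast
  qed
qed

text \<open>The sign of \<open>u\<close> at \<open>T\<close> places \<open>T\<close> at
  \<open>B\<close> or beyond it as seen from \<open>A\<close>. So \<open>B\<close> lies between
  \<open>M\<close> and \<open>T\<close>, and convexity applies.\<close>

lemma vertex_inside:
  assumes S: "0 < lor u (hom A)" "lor u (hom B) = 0"
    and M: "M \<in> open_segment A B" "M \<in> hplane" "lor E (hom M) \<le> wgt M"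
    and T: "T \<in> hline A B" "lor E (hom T) \<le> wgt T" "lor u (hom T) \<le> 0"
  shows "lor E (hom B) \<le> wgt B"
proof -
  have Th: "T \<in> hplane" using T(1) by (simp add: hline_def)
  obtain a t where at: "T = a *\<^sub>R A + t *\<^sub>R B" "a + t = 1"
    using T(1) by (auto simp: hline_def affine_hull_2)
  then have t: "T = (1 - t) *\<^sub>R A + t *\<^sub>R B" by (simp add: eq_diff_eq[symmetric])
  then have "(1 - t) * lor u (hom A) \<le> 0"
    using T(3) S(2) by (simp add: hom_affine)
  then have "1 \<le> t" using S(1) by (simp add: mult_le_0_iff)
  obtain m where m: "0 < m" "m < 1" "M = (1 - m) *\<^sub>R A + m *\<^sub>R B"
    using M(1) by (rule open_segmentE)
  \<comment> \<open>The position of \<open>B\<close> on the segment from \<open>M\<close> to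
    \<open>T\<close>, whose parameters along \<open>AB\<close> are \<open>m < 1\<close> and
    \<open>t \<ge> 1\<close>.\<close>
  define k where "k = (1 - m) / (t - m)"
  have k: "0 \<le> k" "k \<le> 1" "k * (t - m) = 1 - m"
    using m \<open>1 \<le> t\<close> by (auto simp: k_def)
  have c: "(1 - k) * (1 - m) + k * (1 - t) = 0" "(1 - k) * m + k * t = 1"
    using k(3) by (simp_all add: algebra_simps)
  have "(1 - k) *\<^sub>R M + k *\<^sub>R T =
      ((1 - k) * (1 - m) + k * (1 - t)) *\<^sub>R A + ((1 - k) * m + k * t) *\<^sub>R B"
    unfolding m(3) t by (simp add: scaleR_add_left scaleR_add_right)
  then have "(1 - k) *\<^sub>R M + k *\<^sub>R T = B" by (simp add: c)
  then show ?thesis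
    using section_interior_convex[OF M(2) Th k(1,2) M(3) T(2)] by simp
qed

text \<open>A circle internally tangent to the excircle would have to enclose it, hence also its
  contact points with the other two sides; convexity then puts the side opposite the vertex into
  the interior.\<close>

lemma excircle_not_internally_tangent:
  assumes S: "side_normals A B C u v w"
    and F: "F \<in> hplane" and s: "0 < s" "0 < e"
    and N: "N = hyp F + s *\<^sub>R n" and E: "E = hyp F + e *\<^sub>R n"
    and Ta: "Ta \<in> hplane" "N = hyp Ta + s *\<^sub>R u"
    and Tb: "Tb \<in> hline C A" "Tb \<in> psection N" "lor u (hom Tb) \<le> 0"
    and Tc: "Tc \<in> hline A B" "Tc \<in> psection N" "lor u (hom Tc) \<le> 0"
    and Ma: "Ma \<in> open_segment B C" "Ma \<in> psection E"
    and Mb: "Mb \<in> open_segment C A" "Mb \<in> psection E"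
    and Mc: "Mc \<in> open_segment A B" "Mc \<in> psection E"
  shows False
proof -
  note h = side_normals_hplane[OF S]
  have Mh: "Ma \<in> hplane" "Mb \<in> hplane" "Mc \<in> hplane"
    using Ma Mb Mc by (auto simp: psection_def)
  \<comment> \<open>For circles touching one line at \<open>F\<close> from the same side, the larger
    factor encloses the other circle. With \<open>e \<le> s\<close> the point \<open>Mb\<close>
    would be enclosed by the excircle, yet it lies strictly on the side of \<open>BC\<close>
    containing \<open>A\<close>.\<close>
  have "s < e"
  proof (rule ccontr)
    assume "\<not> s < e"
    obtain t where t: "0 < t" "t < 1" "Mb = (1 - t) *\<^sub>R C + t *\<^sub>R A"
      using Mb(1) by (rule open_segmentE)
    then have "0 < lor u (hom Mb)" using S by (simp add: hom_affine side_normals_def)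
    then have "0 < s * lor u (hyp Mb)"
      using s(1) wgt_pos[OF Mh(2)] by (simp add: hyp_def)
    moreover have "lor N (hyp Mb) = lor (hyp Ta) (hyp Mb) + s * lor u (hyp Mb)"
      by (simp add: Ta(2))
    ultimately have "1 < lor N (hyp Mb)" using lor_hyp_ge[OF Ta(1) Mh(2)] by linarith
    moreover have "lor N (hyp Mb) = lor (hyp F) (hyp Mb) + s * lor n (hyp Mb)"
      by (simp add: N)
    moreover have e: "e * lor n (hyp Mb) = 1 - lor (hyp F) (hyp Mb)"
      by (rule lor_psection_normal[OF E Mb(2)])
    moreover have "s * lor n (hyp Mb) \<le> e * lor n (hyp Mb)"
    proof (rule mult_right_mono_neg)
      have "e * lor n (hyp Mb) \<le> 0" using e lor_hyp_ge[OF F Mh(2)] by simp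
      then show "lor n (hyp Mb) \<le> 0" using s(2) by (simp add: mult_le_0_iff)
    qed (use \<open>\<not> s < e\<close> in simp)
    ultimately show False by linarith
  qed
  have inside: "lor E (hom T) \<le> wgt T" if T: "T \<in> psection N" for T
  proof -
    have Th: "T \<in> hplane" using T by (simp add: psection_def)
    have e: "s * lor n (hyp T) = 1 - lor (hyp F) (hyp T)"
      by (rule lor_psection_normal[OF N T])
    then have "s * lor n (hyp T) \<le> 0" using lor_hyp_ge[OF F Th] by simp
    then have "lor n (hyp T) \<le> 0" using s(1) by (simp add: mult_le_0_iff)
    then have "e * lor n (hyp T) \<le> s * lor n (hyp T)"
      using \<open>s < e\<close> by (intro mult_right_mono_neg) auto
    moreover have "lor E (hyp T) = lor (hyp F) (hyp T) + e * lor n (hyp T)" by (simp add: E)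
    ultimately have "lor E (hyp T) \<le> 1" using e by simp
    then show ?thesis using lor_hyp_le_1_iff[OF Th] by simp
  qed
  have on: "lor E (hom M) = wgt M" if "M \<in> psection E" for M
    using that lor_hyp_eq_1_iff[of M E] by (auto simp: psection_def)
  have "lor E (hom B) \<le> wgt B"
    using S vertex_inside[OF _ _ Mc(1) Mh(3) _ Tc(1) inside[OF Tc(2)] Tc(3)] on[OF Mc(2)]
    by (simp add: side_normals_def)
  moreover have "lor E (hom C) \<le> wgt C"
  proof -
    have "Mb \<in> open_segment A C" "Tb \<in> hline A C"
      using Mb(1) Tb(1) by (simp_all add: open_segment_commute hline_def insert_commute)
    then show ?thesis
      using S vertex_inside[of u A C Mb E Tb] Mh(2) inside[OF Tb(2)] Tb(3) on[OF Mb(2)]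
      by (simp add: side_normals_def)
  qed
  ultimately show False
    using open_segmentE[OF Ma(1)] section_interior_strict_convex[of B C _ E] h on[OF Ma(2)]
    by (metis less_irrefl)
qed

section \<open>The escribed circles\<close>

lemma angle_region_normals:
  assumes S: "side_normals A B C u v w" and X: "X \<in> angle_region B A C"
  shows "0 \<le> lor v (hom X)" "0 \<le> lor w (hom X)"
proof -
  obtain s t where st: "X = A + s *\<^sub>R (B - A) + t *\<^sub>R (C - A)" "0 \<le> s" "0 \<le> t"
    using X by (auto simp: angle_region_def)
  then have "hom X = (1 - s - t) *\<^sub>R hom A + s *\<^sub>R hom B + t *\<^sub>R hom C"
    by (simp add: hom_def algebra_simps)
  then show "0 \<le> lor v (hom X)" "0 \<le> lor w (hom X)"
    using S st by (simp_all add: side_normals_def)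
qed

lemma opposite_side_normal:
  assumes S: "side_normals A B C u v w" and X: "X \<in> opposite_side A B C"
  shows "lor u (hom X) \<le> 0"
proof -
  have u: "0 < lor u (hom A)" "lor u (hom B) = 0" "lor u (hom C) = 0"
    using S by (auto simp: side_normals_def)
  obtain Y where Y: "Y \<in> closed_segment A X" "Y \<in> hline B C"
    using X by (auto simp: opposite_side_def)
  obtain t where t: "0 \<le> t" "t \<le> 1" "Y = (1 - t) *\<^sub>R A + t *\<^sub>R X"
    using Y(1) by (auto simp: in_segment)
  have eq: "(1 - t) * lor u (hom A) + t * lor u (hom X) = 0"
    using lor_hline[OF u(2,3) Y(2)] by (simp add: t(3) hom_affine)
  then have "t \<noteq> 0" using u(1) by auto
  moreover have "t * lor u (hom X) \<le> 0"
    using eq u(1) t(2) mult_nonneg_nonneg[of "1 - t" "lor u (hom A)"] by linarith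
  ultimately show ?thesis using t(1) by (simp add: mult_le_0_iff)
qed

text \<open>The region containing the circle fixes the signs, so \<open>tangent_normal_side\<close>
  applies with \<open>- u\<close>, \<open>v\<close> and \<open>w\<close>. The contact points are
  kept for the exclusion of internal contact.\<close>

lemma escribed_circle_normals:
  assumes S: "side_normals A B C u v w" and esc: "escribed_circle A B C \<omega>"
  obtains N Ta Tb Tc where "\<omega> = psection N" "0 < rad N"
    "lor u N = - rad N" "lor v N = rad N" "lor w N = rad N"
    "Ta \<in> hplane" "N = hyp Ta + rad N *\<^sub>R u"
    "Tb \<in> hline C A" "Tb \<in> psection N" "lor u (hom Tb) \<le> 0"
    "Tc \<in> hline A B" "Tc \<in> psection N" "lor u (hom Tc) \<le> 0"
proof -
  obtain N where N: "\<omega> = psection N"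
    using esc generalized_circle_psection unfolding escribed_circle_def by blast
  have sub: "X \<in> angle_region B A C" "X \<in> opposite_side A B C" if "X \<in> psection N" for X
    using esc that N by (auto simp: escribed_circle_def)
  obtain Ta Tb Tc where T: "tangent_line_at (hline B C) (psection N) Ta"
    "tangent_line_at (hline C A) (psection N) Tb" "tangent_line_at (hline A B) (psection N) Tc"
    using esc N by (auto simp: escribed_circle_def tangent_to_sidelines_def tangent_line_def)
  note s = S[unfolded side_normals_def]
  have ta: "0 < rad N" "N = hyp Ta - rad N *\<^sub>R (- u)" "lor (- u) N = rad N"
    using s opposite_side_normal[OF S sub(2)]
    by (intro tangent_normal_side[OF T(1), of "- u"]; simp)+
  have tb: "lor v N = rad N"
    using s angle_region_normals(1)[OF S sub(1)]
    by (intro tangent_normal_side[OF T(2), of v]; simp)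
  have tc: "lor w N = rad N"
    using s angle_region_normals(2)[OF S sub(1)]
    by (intro tangent_normal_side[OF T(3), of w]; simp)
  show thesis
    by (rule that[OF N ta(1) _ tb tc, of Ta Tb Tc])
      (use ta tangent_line_atD[OF T(1)] tangent_line_atD[OF T(2)] tangent_line_atD[OF T(3)]
        opposite_side_normal[OF S sub(2)] in auto)
qed

text \<open>\<open>J\<close> stands for the incircle vector divided by its \<open>rad\<close>, and
  enters only through its pairings with the normals. The signs of \<open>a\<close> and
  \<open>b\<close> later place the common point inside the disc.\<close>

lemma excircle_contact_line:
  assumes S: "side_normals A B C u v w"
    and esc: "escribed_circle A B C \<omega>" and F: "point_of_contact (psection E) \<omega> F"
    and Ma: "Ma \<in> open_segment B C" "Ma \<in> psection E"
    and Mb: "Mb \<in> open_segment C A" "Mb \<in> psection E"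
    and Mc: "Mc \<in> open_segment A B" "Mc \<in> psection E"
    and J: "lor u J = 1" "lor v J = 1" "lor w J = 1"
  shows "F \<in> hplane \<and> (\<exists>a>0. \<exists>b>0. (1 / rad E) *\<^sub>R E + J = a *\<^sub>R hom A + b *\<^sub>R hom F)"
proof -
  obtain N Ta Tb Tc where N: "\<omega> = psection N" "0 < rad N"
    "lor u N = - rad N" "lor v N = rad N" "lor w N = rad N"
    and Ta: "Ta \<in> hplane" "N = hyp Ta + rad N *\<^sub>R u"
    and Tb: "Tb \<in> hline C A" "Tb \<in> psection N" "lor u (hom Tb) \<le> 0"
    and Tc: "Tc \<in> hline A B" "Tc \<in> psection N" "lor u (hom Tc) \<le> 0"
    using escribed_circle_normals[OF S esc] by metis
  obtain n where Fh: "F \<in> hplane" "0 < rad E" and n: "E = hyp F + rad E *\<^sub>R n"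
    "N = hyp F + rad N *\<^sub>R n \<or> N = hyp F - rad N *\<^sub>R n"
    using point_of_contact_normal[of E N F] F N(1) by blast
  have N_eq: "N = hyp F - rad N *\<^sub>R n"
    using n excircle_not_internally_tangent[OF S Fh(1) N(2) Fh(2) _ n(1) Ta Tb Tc Ma Mb Mc]
    by blast
  define z where "z = J - (1 / rad N) *\<^sub>R N"
  have "lor v z = 0" "lor w z = 0" "lor u z = 2"
    using N J by (simp_all add: z_def)
  then have z: "z = (2 / lor u (hom A)) *\<^sub>R hom A"
    using orthogonal_to_two_sides[OF S] by metis
  have e: "(1 / rad E) *\<^sub>R E = (1 / rad E) *\<^sub>R hyp F + n"
    using arg_cong[OF n(1), of "\<lambda>p. (1 / rad E) *\<^sub>R p"] Fh(2) by (simp add: scaleR_add_right)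
  have i: "(1 / rad N) *\<^sub>R N = (1 / rad N) *\<^sub>R hyp F - n"
    using arg_cong[OF N_eq, of "\<lambda>p. (1 / rad N) *\<^sub>R p"] N(2) by (simp add: scaleR_diff_right)
  have "(1 / rad E) *\<^sub>R E + J = z + ((1 / rad E) *\<^sub>R E + (1 / rad N) *\<^sub>R N)"
    by (simp add: z_def)
  \<comment> \<open>The contact is external, so the multiples of \<open>n\<close> cancel in the
    sum.\<close>
  also have "(1 / rad E) *\<^sub>R E + (1 / rad N) *\<^sub>R N = (1 / rad E + 1 / rad N) *\<^sub>R hyp F"
    unfolding e i by (simp add: scaleR_add_left)
  also have "\<dots> = ((1 / rad E + 1 / rad N) / wgt F) *\<^sub>R hom F"
    by (simp add: hyp_def)
  finally have "(1 / rad E) *\<^sub>R E + J =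
      (2 / lor u (hom A)) *\<^sub>R hom A + ((1 / rad E + 1 / rad N) / wgt F) *\<^sub>R hom F"
    unfolding z .
  moreover have "0 < 2 / lor u (hom A)" using S by (simp add: side_normals_def)
  moreover have "0 < (1 / rad E + 1 / rad N) / wgt F"
    using Fh N(2) wgt_pos by (simp add: add_pos_pos)
  ultimately show ?thesis using Fh(1) by blast
qed

section \<open>The inscribed circle\<close>

lemma hull_normals:
  assumes S: "side_normals A B C u v w" and X: "X \<in> convex hull {A, B, C}"
  shows "0 \<le> lor w (hom X)" "lor w (hom X) = 0 \<Longrightarrow> X \<in> closed_segment A B"
proof -
  obtain a b c where abc: "X = a *\<^sub>R A + b *\<^sub>R B + c *\<^sub>R C"
    "0 \<le> a" "0 \<le> b" "0 \<le> c" "a + b + c = 1"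
    using X by (auto simp: convex_hull_3)
  have "lor w (hom X) = c * lor w (hom C)" "0 < lor w (hom C)"
    using S abc by (simp_all add: hom_affine3 side_normals_def)
  then show "0 \<le> lor w (hom X)" "lor w (hom X) = 0 \<Longrightarrow> X \<in> closed_segment A B"
  proof -
    assume "lor w (hom X) = 0"
    then have "c = 0" using \<open>lor w (hom X) = c * _\<close> \<open>0 < _\<close> by simp
    then have "X = (1 - b) *\<^sub>R A + b *\<^sub>R B" "b \<le> 1" using abc by auto
    then show "X \<in> closed_segment A B" using abc(3) by (auto simp: in_segment)
  qed (use abc(4) in simp)
qed

text \<open>A contact point on the line \<open>AB\<close> that belongs to the triangle lies on the
  side itself; the exclusion of external contact relies on this.\<close>

lemma inscribed_side:
  assumes S: "side_normals A B C u v w"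
    and tan: "tangent_line (hline A B) (psection N)" and sub: "psection N \<subseteq> convex hull {A, B, C}"
  obtains T where "T \<in> closed_segment A B" "N = hyp T - rad N *\<^sub>R w" "0 < rad N" "lor w N = rad N"
proof -
  obtain T where T: "tangent_line_at (hline A B) (psection N) T"
    using tan by (auto simp: tangent_line_def)
  note D = tangent_line_atD[OF T]
  have w: "lor w w = -1" "lor w (hom A) = 0" "lor w (hom B) = 0"
    using S by (auto simp: side_normals_def)
  have "0 \<le> lor w (hom X)" if "X \<in> psection N" for X
    using hull_normals(1)[OF S] sub that by blast
  note * = tangent_normal_side[OF T w this]
  have "T \<in> closed_segment A B"
    using hull_normals(2)[OF S] sub D lor_hline[OF w(2,3)] by blast
  then show thesis using that * by blast
qed

lemma incircle_contact_line:
  assumes S: "side_normals A B C u v w"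
    and ins: "inscribed_circle A B C Z r" and F: "point_of_contact (psection E) (hcircle Z r) F"
    and Ma: "Ma \<in> open_segment B C" "Ma \<in> psection E"
    and Mb: "Mb \<in> open_segment C A" "Mb \<in> psection E"
    and Mc: "Mc \<in> open_segment A B" "Mc \<in> psection E"
  obtains J k l where "lor u J = 1" "lor v J = 1" "lor w J = 1"
    "(1 / rad E) *\<^sub>R E + J = k *\<^sub>R hom F + l *\<^sub>R hom Z"
proof -
  note S' = side_normals_rotate[OF S]
  note S'' = side_normals_rotate[OF S']
  obtain m where "0 < m" "hcircle Z r = psection (m *\<^sub>R hom Z)"
    using ins hcircle_psection[of Z r] by (auto simp: inscribed_circle_def)
  then obtain N where N: "hcircle Z r = psection N" "N = m *\<^sub>R hom Z" by blast
  have sub: "psection N \<subseteq> convex hull {A, B, C}" "psection N \<subseteq> convex hull {B, C, A}"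
    "psection N \<subseteq> convex hull {C, A, B}"
    using ins N(1) by (simp_all add: inscribed_circle_def insert_commute)
  have tan: "tangent_line (hline B C) (psection N)" "tangent_line (hline C A) (psection N)"
    "tangent_line (hline A B) (psection N)"
    using ins N(1) by (simp_all add: inscribed_circle_def tangent_to_sidelines_def)
  obtain Ta where Ta: "Ta \<in> closed_segment B C" "N = hyp Ta - rad N *\<^sub>R u" and u: "lor u N = rad N"
    using inscribed_side[OF S' tan(1) sub(2)] by metis
  obtain Tb where Tb: "Tb \<in> closed_segment C A" "N = hyp Tb - rad N *\<^sub>R v" and v: "lor v N = rad N"
    using inscribed_side[OF S'' tan(2) sub(3)] by metis
  obtain Tc where Tc: "Tc \<in> closed_segment A B" "N = hyp Tc - rad N *\<^sub>R w" and w: "lor w N = rad N"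
    using inscribed_side[OF S tan(3) sub(1)] by metis
  obtain n where Fh: "F \<in> hplane" "0 < rad E" "0 < rad N" and n: "E = hyp F + rad E *\<^sub>R n"
    "N = hyp F + rad N *\<^sub>R n \<or> N = hyp F - rad N *\<^sub>R n"
    using point_of_contact_normal[of E N F] F N(1) by metis
  \<comment> \<open>The exclusion lemma gives the plus sign to \<open>N\<close> rather than to
    \<open>E\<close>, so it is used with \<open>- n\<close>.\<close>
  have N_eq: "N = hyp F + rad N *\<^sub>R n"
    using n incircle_not_externally_tangent[OF S Fh(1,3,2), of N "- n" E, OF _ _ Ta Tb Tc Ma Mb Mc]
    by auto
  have e: "(1 / rad E) *\<^sub>R E = (1 / rad E) *\<^sub>R hyp F + n"
    using arg_cong[OF n(1), of "\<lambda>p. (1 / rad E) *\<^sub>R p"] Fh(2) by (simp add: scaleR_add_right)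
  have i: "(1 / rad N) *\<^sub>R N = (1 / rad N) *\<^sub>R hyp F + n"
    using arg_cong[OF N_eq, of "\<lambda>p. (1 / rad N) *\<^sub>R p"] Fh(3) by (simp add: scaleR_add_right)
  let ?J = "(1 / rad N) *\<^sub>R N"
  \<comment> \<open>The contact is internal, so \<open>n\<close> cancels in the difference instead.
    The remaining \<open>2 *\<^sub>R ?J\<close> is a multiple of \<open>hom Z\<close>; the
    coefficient of \<open>hom F\<close> may have either sign.\<close>
  have "(1 / rad E) *\<^sub>R E + ?J = (1 / rad E) *\<^sub>R E - ?J + 2 *\<^sub>R ?J" by (simp only: scaleR_2) simp
  also have "(1 / rad E) *\<^sub>R E - ?J = (1 / rad E - 1 / rad N) *\<^sub>R hyp F"
    unfolding e i by (simp add: scaleR_diff_left)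
  also have "\<dots> = ((1 / rad E - 1 / rad N) / wgt F) *\<^sub>R hom F" by (simp add: hyp_def)
  also have "2 *\<^sub>R ?J = (2 * (1 / rad N) * m) *\<^sub>R hom Z"
    using arg_cong[OF N(2), of "\<lambda>p. 2 *\<^sub>R (1 / rad N) *\<^sub>R p"] by simp
  finally show thesis using that[of ?J] u v w Fh(3) by simp
qed

section \<open>The common point\<close>

text \<open>Central projection back to height 1: a linear relation between vectors becomes
  collinearity, whatever the signs of the coefficients.\<close>

lemma affine_hull_of_hom:
  assumes "p = a *\<^sub>R hom X + b *\<^sub>R hom Y" "fst p \<noteq> 0"
  shows "(1 / fst p) *\<^sub>R snd p \<in> affine hull {X, Y}"
proof -
  have "fst p = a + b" "snd p = a *\<^sub>R X + b *\<^sub>R Y" using assms(1) by (simp_all add: hom_def)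
  moreover from this have "a / fst p + b / fst p = 1"
    using assms(2) by (simp add: add_divide_distrib[symmetric])
  ultimately have "(1 / fst p) *\<^sub>R snd p = (a / fst p) *\<^sub>R X + (b / fst p) *\<^sub>R Y \<and>
      a / fst p + b / fst p = 1"
    by (simp add: scaleR_add_right)
  then show ?thesis unfolding affine_hull_2 by blast
qed

text \<open>With positive coefficients the projection is a convex combination of two points of the
  disc.\<close>

lemma hplane_of_hom:
  assumes "p = a *\<^sub>R hom X + b *\<^sub>R hom Y" "0 < a" "0 < b" "X \<in> hplane" "Y \<in> hplane"
  shows "0 < fst p" "(1 / fst p) *\<^sub>R snd p \<in> hplane"
proof -
  have p: "fst p = a + b" "snd p = a *\<^sub>R X + b *\<^sub>R Y" using assms(1) by (simp_all add: hom_def)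
  then show pos: "0 < fst p" using assms(2,3) by simp
  have "1 - b / fst p = a / fst p" using pos p(1) by (simp add: field_simps)
  then have "(1 / fst p) *\<^sub>R snd p = (1 - b / fst p) *\<^sub>R X + (b / fst p) *\<^sub>R Y"
    by (simp add: p(2) scaleR_add_right)
  then show "(1 / fst p) *\<^sub>R snd p \<in> hplane"
    using convex_combination_hplane[OF assms(4,5), of "b / fst p"] assms(2,3) p(1) pos by simp
qed

theorem theorem11:
  fixes A B C I F Fa Fb Fc :: point
    and r :: real
    and \<epsilon> \<omega>a \<omega>b \<omega>c :: "point set"
  assumes "htriangle A B C"
    and "euler_circle A B C \<epsilon>"
    and "inscribed_circle A B C I r"
    and "escribed_circle A B C \<omega>a"
    and "escribed_circle B C A \<omega>b"
    and "escribed_circle C A B \<omega>c"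
    and "point_of_contact \<epsilon> (hcircle I r) F"
    and "point_of_contact \<epsilon> \<omega>a Fa"
    and "point_of_contact \<epsilon> \<omega>b Fb"
    and "point_of_contact \<epsilon> \<omega>c Fc"
  shows "\<exists>P. P \<in> hline F I \<and> P \<in> hline A Fa \<and> P \<in> hline B Fb \<and> P \<in> hline C Fc"
proof -
  obtain u v w where S: "side_normals A B C u v w"
    using side_normals_exist[OF assms(1)] by blast
  note S' = side_normals_rotate[OF S]
  note S'' = side_normals_rotate[OF S']
  obtain E where E: "\<epsilon> = psection E"
    using assms(2) generalized_circle_psection unfolding euler_circle_def by blast
  obtain Ma Mb Mc where M: "Ma \<in> psection E" "Mb \<in> psection E" "Mc \<in> psection E"
    and foot: "bisecting_foot A B C Ma" "bisecting_foot B C A Mb" "bisecting_foot C A B Mc"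
    using assms(2) by (auto simp: euler_circle_def E)
  note tri = htriangle_rotate[OF assms(1)]
  have seg: "Ma \<in> open_segment B C" "Mb \<in> open_segment C A" "Mc \<in> open_segment A B"
    using foot bisecting_foot_open_segment assms(1) tri htriangle_rotate[OF tri] by blast+
  obtain J k l where J: "lor u J = 1" "lor v J = 1" "lor w J = 1"
    and FI: "(1 / rad E) *\<^sub>R E + J = k *\<^sub>R hom F + l *\<^sub>R hom I"
    using incircle_contact_line[OF S assms(3) assms(7)[unfolded E] seg(1) M(1) seg(2) M(2) seg(3) M(3)]
    by blast
  define p where "p = (1 / rad E) *\<^sub>R E + J"
  have a: "Fa \<in> hplane" "\<exists>a>0. \<exists>b>0. p = a *\<^sub>R hom A + b *\<^sub>R hom Fa"
    using excircle_contact_line[OF S assms(4) assms(8)[unfolded E]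
        seg(1) M(1) seg(2) M(2) seg(3) M(3) J] by (simp_all add: p_def)
  have b: "\<exists>a>0. \<exists>b>0. p = a *\<^sub>R hom B + b *\<^sub>R hom Fb"
    using excircle_contact_line[OF S' assms(5) assms(9)[unfolded E]
        seg(2) M(2) seg(3) M(3) seg(1) M(1) J(2,3,1)] by (simp add: p_def)
  have c: "\<exists>a>0. \<exists>b>0. p = a *\<^sub>R hom C + b *\<^sub>R hom Fc"
    using excircle_contact_line[OF S'' assms(6) assms(10)[unfolded E]
        seg(3) M(3) seg(1) M(1) seg(2) M(2) J(3,1,2)] by (simp add: p_def)
  let ?P = "(1 / fst p) *\<^sub>R snd p"
  \<comment> \<open>The relation at \<open>A\<close> alone shows that the point is in the disc; on
    the other lines only affine incidence remains to be checked.\<close>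
  have P: "0 < fst p" "?P \<in> hplane"
    using a hplane_of_hom side_normals_hplane[OF S] by blast+
  then have "fst p \<noteq> 0" by simp
  then have "?P \<in> affine hull {F, I}" "?P \<in> affine hull {A, Fa}"
    "?P \<in> affine hull {B, Fb}" "?P \<in> affine hull {C, Fc}"
    using a(2) b c FI affine_hull_of_hom[of p] unfolding p_def[symmetric] by blast+
  then show ?thesis using P(2) unfolding hline_def by blast
qed

end
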